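(* Let $G=(V,E)$ be a finite simple graph with $V\neq\emptyset$ and $E\neq\emptyset$, and fix $e\in E$. For $i\geq 1$ let $$b_e^i(G)=\sum_{F\in\mathcal{B}_e^i}(-1)^{|F|},$$ where $\mathcal{B}_e^i$ is the collection of all $F\subseteq E$ such that $e$ is a bridge in $F$ and $k(F)=i$. Then for $i=1,2,3,\dots$, $$b_e^i(G)=-\sum_{\substack{V=V_1\sqcup\cdots\sqcup V_{i+1}\\ e\notin G[V_j],\ j=1,\dots,i+1}}\ \prod_{j=1}^{i+1}a_1(G[V_j]),$$ where the sum is over all (unordered) decompositions of $V$ into $i+1$ non-empty disjoint subsets $V_1,\dots,V_{i+1}$ such that $e$ is not an edge of any $G[V_j]$.
   Context: For $F\subseteq E$, $k(F)$ denotes the number of connected components of the spanning subgraph $(V,F)$ (isolated vertices count as components). An edge $e$ is a bridge in $F$ if $e\in F$ and $k(F\setminus\{e\})=k(F)+1$. For non-empty $V'\subseteq V$, $G[V']$ is the subgraph of $G$ induced by $V'$. For any finite simple graph $G'=(V',E')$, $a_1(G')=\sum_{F\subseteq E',\,k(F)=1}(-1)^{|F|}$, where $k(F)$ is the number of connected components of $(V',F)$; this is the coefficient of $\lambda$ in the chromatic polynomial of $G'$. An empty sum is $0$. *)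

theory Defs
  imports "HOL-Library.Disjoint_Sets"
begin

text \<open>
  A graph is given by its vertex set \<^term>\<open>V\<close> and its edge set \<^term>\<open>E\<close>, an edge being a
  two-element set of vertices.  Representing edges as unordered pairs makes \<open>card F\<close>
  count each undirected edge once.
\<close>

definition fin_simple_graph :: "'a set \<Rightarrow> 'a set set \<Rightarrow> bool" where
  "fin_simple_graph V E \<longleftrightarrow> finite V \<and> (\<forall>e\<in>E. e \<subseteq> V \<and> card e = 2)"

definition connectedness :: "'a set \<Rightarrow> 'a set set \<Rightarrow> 'a rel" where
  "connectedness V F = {(u, v). u \<in> V \<and> v \<in> V \<and> (u, v) \<in> {(x, y). {x, y} \<in> F}\<^sup>*}"

definition components :: "'a set \<Rightarrow> 'a set set \<Rightarrow> 'a set set" where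
  "components V F = V // connectedness V F"

definition num_components :: "'a set \<Rightarrow> 'a set set \<Rightarrow> nat" where
  "num_components V F = card (components V F)"

definition is_bridge :: "'a set \<Rightarrow> 'a set set \<Rightarrow> 'a set \<Rightarrow> bool" where
  "is_bridge V F e \<longleftrightarrow> e \<in> F \<and> num_components V (F - {e}) = num_components V F + 1"

text \<open>The edge set of the induced subgraph \<open>G[U]\<close>, whose vertex set is \<open>U\<close>.\<close>

definition induced_edges :: "'a set set \<Rightarrow> 'a set \<Rightarrow> 'a set set" where
  "induced_edges E U = {e \<in> E. e \<subseteq> U}"

definition a1 :: "'a set \<Rightarrow> 'a set set \<Rightarrow> int" where
  "a1 V E = (\<Sum>F\<in>{F. F \<subseteq> E \<and> num_components V F = 1}. (- 1) ^ card F)"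

definition bridge_family :: "'a set \<Rightarrow> 'a set set \<Rightarrow> 'a set \<Rightarrow> nat \<Rightarrow> 'a set set set" where
  "bridge_family V E e i = {F. F \<subseteq> E \<and> is_bridge V F e \<and> num_components V F = i}"

definition bridge_sum :: "'a set \<Rightarrow> 'a set set \<Rightarrow> 'a set \<Rightarrow> nat \<Rightarrow> int" where
  "bridge_sum V E e i = (\<Sum>F\<in>bridge_family V E e i. (- 1) ^ card F)"

lemma equiv_connectedness: "equiv V (connectedness V F)"
proof (rule equivI)
  have "sym ({(x, y). {x, y} \<in> F}\<^sup>*)"
    by (rule sym_rtrancl) (auto simp: sym_def insert_commute)
  then show "sym (connectedness V F)"
    by (auto simp: sym_def connectedness_def)
qed (auto simp: refl_on_def trans_def connectedness_def)

lemma partition_on_components: "partition_on V (components V F)"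
  unfolding components_def by (rule partition_on_quotient[OF equiv_connectedness])

end

theory Submission
  imports Defs "HOL-Library.FuncSet"
begin

text \<open>
  Deleting the bridge \<open>e\<close> splits one component and leaves an edge set whose components are exactly
  \<open>i + 1\<close> in number, none of which contains \<open>e\<close>; conversely, adding \<open>e\<close> to such an edge set makes it
  a bridge.  Deletion flips the sign.  Grouping the resulting edge sets by their partition into
  components, an edge set inducing a given partition is an independent choice of a connected
  spanning edge set in each block, so each group contributes a product of \<open>a1\<close> values.
\<close>

section \<open>Connected edge sets and monotonicity\<close>

lemma num_components_eq_1_iff:
  "num_components U F = 1 \<longleftrightarrow> U \<noteq> {} \<and> U \<times> U \<subseteq> connectedness U F"
proof
  assume "num_components U F = 1"
  then obtain A where A: "components U F = {A}"
    by (auto simp: num_components_def card_1_singleton_iff)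
  then have "partition_on U {A}"
    using partition_on_components[of U F] by simp
  then have UA: "U = A" "A \<noteq> {}"
    by (auto simp: partition_on_def)
  have "connectedness U F `` {u} = U" if "u \<in> U" for u
    using A UA(1) quotientI[OF that, of "connectedness U F"] by (simp add: components_def)
  then have "U \<times> U \<subseteq> connectedness U F" by blast
  with UA show "U \<noteq> {} \<and> U \<times> U \<subseteq> connectedness U F" by simp
next
  assume U: "U \<noteq> {} \<and> U \<times> U \<subseteq> connectedness U F"
  moreover have "connectedness U F \<subseteq> U \<times> U"
    by (auto simp: connectedness_def)
  ultimately have "U \<noteq> {}" "connectedness U F = U \<times> U" by blast+
  then have "components U F = {U}"
    by (auto simp: components_def quotient_def)
  then show "num_components U F = 1"
    by (simp add: num_components_def)
qed

lemma connectedness_mono: "U \<subseteq> W \<Longrightarrow> F \<subseteq> H \<Longrightarrow> connectedness U F \<subseteq> connectedness W H"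
  using rtrancl_mono[of "{(x, y). {x, y} \<in> F}" "{(x, y). {x, y} \<in> H}"]
  by (auto simp: connectedness_def)

lemma connectedness_edge: "{x, y} \<in> F \<Longrightarrow> {x, y} \<subseteq> V \<Longrightarrow> (x, y) \<in> connectedness V F"
  by (auto simp: connectedness_def)

text \<open>In the form given by \<open>num_components_eq_1_iff\<close>, being connected is an
  inclusion whose right-hand side grows with the edge set.\<close>

lemma connected_mono:
  assumes "num_components U F = 1" "F \<subseteq> H"
  shows "num_components U H = 1"
  using assms connectedness_mono[OF order_refl assms(2)] unfolding num_components_eq_1_iff by blast

lemma induced_edges_mono: "F \<subseteq> H \<Longrightarrow> induced_edges F U \<subseteq> induced_edges H U"
  by (auto simp: induced_edges_def)

section \<open>Recognising the components among the partitions of the vertex set\<close>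

lemma partition_on_block_unique:
  "partition_on V P \<Longrightarrow> U \<in> P \<Longrightarrow> W \<in> P \<Longrightarrow> x \<in> U \<Longrightarrow> x \<in> W \<Longrightarrow> U = W"
  by (auto simp: partition_on_def disjoint_def)

text \<open>Induction along the path: the next edge lies in some block, and that block shares the
  current vertex with \<open>U\<close>, so it is \<open>U\<close>. Hence a path never leaves its
  block and uses only edges induced on it.\<close>

lemma path_within_block:
  assumes P: "partition_on V P" and F: "\<And>f. f \<in> F \<Longrightarrow> \<exists>U\<in>P. f \<subseteq> U"
    and U: "U \<in> P" and u: "u \<in> U"
    and path: "(u, v) \<in> {(x, y). {x, y} \<in> F}\<^sup>*"
  shows "(u, v) \<in> connectedness U (induced_edges F U)"
  using path
proof induction
  case base
  show ?case using u by (simp add: connectedness_def)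
next
  case (step y z)
  then have y: "y \<in> U" by (simp add: connectedness_def)
  obtain W where "W \<in> P" "{y, z} \<subseteq> W" using step F by blast
  then have "{y, z} \<subseteq> U"
    using partition_on_block_unique[OF P U, of W y] y by blast
  then have "(y, z) \<in> connectedness U (induced_edges F U)"
    using step by (intro connectedness_edge) (auto simp: induced_edges_def)
  then show ?case
    using step.IH equiv_connectedness[of U "induced_edges F U"] by (meson equivE transE)
qed

text \<open>Two opposite inclusions show that the class of a vertex is its block: paths cannot leave
  the block, and connectedness of the block makes all of it reachable. Component partitions below
  are computed by exhibiting a candidate \<open>P\<close> and checking these conditions.\<close>

lemma components_eqI:
  assumes P: "partition_on V P" and F: "\<And>f. f \<in> F \<Longrightarrow> \<exists>U\<in>P. f \<subseteq> U"
    and conn: "\<And>U. U \<in> P \<Longrightarrow> num_components U (induced_edges F U) = 1"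
  shows "components V F = P"
proof -
  have cls: "connectedness V F `` {u} = U" if "U \<in> P" "u \<in> U" for u U
  proof
    show "connectedness V F `` {u} \<subseteq> U"
      using path_within_block[OF P F that] by (fastforce simp: connectedness_def)
    have "connectedness U (induced_edges F U) \<subseteq> connectedness V F"
      using P that(1) by (intro connectedness_mono) (auto simp: induced_edges_def partition_on_def)
    then have "U \<times> U \<subseteq> connectedness V F"
      using conn[OF that(1)] unfolding num_components_eq_1_iff by blast
    then show "U \<subseteq> connectedness V F `` {u}" using that by blast
  qed
  show ?thesis
  proof (intro equalityI subsetI)
    fix A assume "A \<in> components V F"
    then obtain u where "u \<in> V" "A = connectedness V F `` {u}"
      by (auto simp: components_def quotient_def)
    then show "A \<in> P" using cls P by (auto simp: partition_on_def)
  next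
    fix U assume U: "U \<in> P"
    then obtain u where u: "u \<in> U" using partition_onD3[OF P] by fastforce
    then have "u \<in> V" using U P by (auto simp: partition_on_def)
    then show "U \<in> components V F"
      using quotientI[of u V "connectedness V F"] cls[OF U u] by (simp add: components_def)
  qed
qed

lemma edge_in_component:
  assumes "fin_simple_graph V F" "f \<in> F"
  shows "\<exists>U\<in>components V F. f \<subseteq> U"
proof -
  obtain x y where f: "f = {x, y}" using assms by (auto simp: fin_simple_graph_def card_2_iff)
  have V: "{x, y} \<subseteq> V" using assms f by (auto simp: fin_simple_graph_def)
  have "f \<subseteq> connectedness V F `` {x}"
    using connectedness_edge[of x y F V] connectedness_edge[of x x F V] assms V f
    by (auto simp: connectedness_def)
  then show ?thesis using V quotientI[of x V "connectedness V F"] by (auto simp: components_def)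
qed

text \<open>Two vertices of a component are joined by a path in \<open>F\<close>. The partition into
  components has every edge inside one block, so \<open>path_within_block\<close> applies to it and
  keeps this path inside \<open>U\<close>.\<close>

lemma component_connected:
  assumes "fin_simple_graph V F" "U \<in> components V F"
  shows "num_components U (induced_edges F U) = 1"
proof -
  have *: "(u, v) \<in> connectedness U (induced_edges F U)" if "u \<in> U" "v \<in> U" for u v
  proof -
    have "(u, v) \<in> connectedness V F"
      using assms(2) that quotient_eq_iff[OF equiv_connectedness, of U V F U u v]
      by (auto simp: components_def)
    then show ?thesis
      using path_within_block[OF partition_on_components edge_in_component[OF assms(1)] assms(2) that(1)]
      by (simp add: connectedness_def)
  qed
  moreover have "U \<noteq> {}"
    using partition_on_components assms(2) by (auto simp: partition_on_def)
  ultimately show ?thesis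
    unfolding num_components_eq_1_iff by auto
qed

text \<open>The last condition concerns each block separately; this is what later turns a signed sum
  over edge sets with prescribed components into a product over blocks.\<close>

lemma components_eq_iff:
  assumes "fin_simple_graph V F"
  shows "components V F = P \<longleftrightarrow> partition_on V P \<and> (\<forall>f\<in>F. \<exists>U\<in>P. f \<subseteq> U) \<and>
    (\<forall>U\<in>P. num_components U (induced_edges F U) = 1)"
  using components_eqI[of V P F] partition_on_components[of V F]
    edge_in_component[OF assms] component_connected[OF assms] by auto

section \<open>The effect of adding an edge on the components\<close>

lemma components_insert_within:
  assumes "fin_simple_graph V F" "U \<in> components V F" "e \<subseteq> U"
  shows "components V (insert e F) = components V F"
proof (rule components_eqI[OF partition_on_components])
  show "\<exists>U\<in>components V F. f \<subseteq> U" if "f \<in> insert e F" for f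
    using that assms edge_in_component[OF assms(1)] by auto
  fix W assume "W \<in> components V F"
  from component_connected[OF assms(1) this]
  show "num_components W (induced_edges (insert e F) W) = 1"
    by (rule connected_mono) (intro induced_edges_mono subset_insertI)
qed

text \<open>The new edge lies in \<open>A \<union> B\<close> and links two connected pieces there,
  while all other components are untouched; \<open>components_eqI\<close> is applied to the merged
  partition.\<close>

lemma components_insert_across:
  assumes G: "fin_simple_graph V F" and A: "A \<in> components V F" "x \<in> A"
    and B: "B \<in> components V F" "y \<in> B" and AB: "A \<noteq> B"
  shows "components V (insert {x, y} F) = insert (A \<union> B) (components V F - {A, B})"
proof (rule components_eqI)
  let ?P = "components V F" and ?F = "insert {x, y} F"
  have P: "partition_on V ?P" by (rule partition_on_components)
  show "partition_on V (insert (A \<union> B) (?P - {A, B}))"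
  proof (rule partition_onI)
    show "\<Union>(insert (A \<union> B) (?P - {A, B})) = V"
      using A B partition_onD1[OF P] by blast
    show "{} \<notin> insert (A \<union> B) (?P - {A, B})"
      using A partition_onD3[OF P] by blast
    show "disjnt p q" if "p \<in> insert (A \<union> B) (?P - {A, B})" "q \<in> insert (A \<union> B) (?P - {A, B})"
      "p \<noteq> q" for p q
      using that A(1) B(1) partition_onD2[OF P] by (auto simp: disjnt_def dest: disjointD)
  qed
  show "\<exists>U\<in>insert (A \<union> B) (?P - {A, B}). f \<subseteq> U" if "f \<in> ?F" for f
  proof (cases "f = {x, y}")
    case True
    then show ?thesis using A(2) B(2) by (intro bexI[of _ "A \<union> B"]) auto
  next
    case False
    then have "f \<in> F" using that by simp
    from edge_in_component[OF G this] obtain U where "U \<in> ?P" "f \<subseteq> U" ..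
    then show ?thesis by (cases "U \<in> {A, B}") auto
  qed
  \<comment> \<open>The larger set \<open>W'\<close> serves two cases: \<open>W' = W\<close> for an
    untouched component, and \<open>W' = A \<union> B\<close> for each of the two merged
    ones.\<close>
  have conn: "W \<times> W \<subseteq> connectedness W' (induced_edges ?F W')" if "W \<in> ?P" "W \<subseteq> W'" for W W'
  proof -
    have "induced_edges F W \<subseteq> induced_edges ?F W'"
      using that(2) by (auto simp: induced_edges_def)
    from connectedness_mono[OF that(2) this] component_connected[OF G that(1)]
    show ?thesis unfolding num_components_eq_1_iff by blast
  qed
  fix W assume W: "W \<in> insert (A \<union> B) (?P - {A, B})"
  let ?C = "connectedness W (induced_edges ?F W)"
  have "W \<noteq> {}" using W A partition_onD3[OF P] by blast
  moreover have "W \<times> W \<subseteq> ?C"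
  proof (cases "W = A \<union> B")
    case False
    then show ?thesis using W by (intro conn) auto
  next
    case True
    have eq: "equiv W ?C" by (rule equiv_connectedness)
    have tr: "(u, w) \<in> ?C" if "(u, v) \<in> ?C" "(v, w) \<in> ?C" for u v w
      using eq that by (meson equivE transE)
    have sy: "(v, u) \<in> ?C" if "(u, v) \<in> ?C" for u v
      using eq that by (meson equivE symE)
    have xy: "(x, y) \<in> ?C"
      using A B True by (intro connectedness_edge) (auto simp: induced_edges_def)
    have "A \<times> A \<subseteq> ?C" "B \<times> B \<subseteq> ?C"
      using conn[OF A(1), of W] conn[OF B(1), of W] True by auto
    \<comment> \<open>Every vertex is reached from \<open>x\<close>, either inside \<open>A\<close>
      or across the new edge to \<open>y\<close> and then inside \<open>B\<close>. Symmetry and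
      transitivity then join any two vertices through \<open>x\<close>.\<close>
    then have "(x, w) \<in> ?C" if "w \<in> W" for w
      using that True A(2) B(2) tr[OF xy, of w] by blast
    then show ?thesis using tr sy by blast
  qed
  ultimately show "num_components W (induced_edges ?F W) = 1"
    unfolding num_components_eq_1_iff by blast
qed

lemma finite_components: "finite V \<Longrightarrow> finite (components V F)"
  using finite_elements[OF _ partition_on_components] .

text \<open>Adding \<open>e\<close> inside a component changes nothing, and adding it across two
  components merges them, which lowers the count by exactly one. Being a bridge thus becomes a
  condition on the partition left after deletion.\<close>

lemma num_components_delete_bridge_iff:
  assumes G: "fin_simple_graph V F" and e: "e \<subseteq> V" "card e = 2"
  shows "num_components V F = num_components V (insert e F) + 1 \<longleftrightarrow>
    (\<forall>U\<in>components V F. \<not> e \<subseteq> U)"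
proof (cases "\<exists>U\<in>components V F. e \<subseteq> U")
  case True
  then obtain U where "U \<in> components V F" "e \<subseteq> U" by blast
  with components_insert_within[OF G this] show ?thesis
    by (auto simp: num_components_def)
next
  case False
  let ?P = "components V F"
  have P: "partition_on V ?P" by (rule partition_on_components)
  obtain x y where xy: "e = {x, y}" using e by (auto simp: card_2_iff)
  have "x \<in> \<Union>?P" "y \<in> \<Union>?P" using P e xy by (auto simp: partition_on_def)
  then obtain A B where A: "A \<in> ?P" "x \<in> A" and B: "B \<in> ?P" "y \<in> B" by blast
  have AB: "A \<noteq> B" using False A B xy by auto
  have fin: "finite ?P" using G by (intro finite_components) (simp add: fin_simple_graph_def)
  \<comment> \<open>A component \<open>A \<union> B\<close> would share \<open>x\<close> with
    \<open>A\<close> and so equal \<open>A\<close>, which has been removed. Hence the insertion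
    really adds one element.\<close>
  have "A \<union> B \<notin> ?P - {A, B}"
    using partition_on_block_unique[OF P A(1), of "A \<union> B" x] A(2) by blast
  then have "card (insert (A \<union> B) (?P - {A, B})) = card (?P - {A, B}) + 1"
    using fin by simp
  also have "card (?P - {A, B}) = card ?P - 2"
    using A B AB fin by (simp add: card_Diff_subset)
  finally have "num_components V (insert e F) = card ?P - 2 + 1"
    using components_insert_across[OF G A B AB] xy by (simp add: num_components_def)
  \<comment> \<open>Guards against truncation in the natural number subtraction
    \<open>card ?P - 2\<close>.\<close>
  moreover have "card ?P \<ge> 2"
    using card_mono[OF fin, of "{A, B}"] A B AB by simp
  ultimately show ?thesis using False by (auto simp: num_components_def)
qed

section \<open>Bridge families and signed sums with prescribed components\<close>

lemma fin_simple_graph_subset: "fin_simple_graph V E \<Longrightarrow> F \<subseteq> E \<Longrightarrow> fin_simple_graph V F"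
  by (auto simp: fin_simple_graph_def)

lemma fin_simple_graph_finite_edges: "fin_simple_graph V E \<Longrightarrow> finite E"
  by (rule finite_subset[of _ "Pow V"]) (auto simp: fin_simple_graph_def)

text \<open>Deleting and inserting \<open>e\<close> are mutually inverse here: every edge of
  \<open>F\<close> lies in a component, so if no component contains \<open>e\<close>, then
  \<open>e\<close> is not in \<open>F\<close>. The shift to \<open>i + 1\<close> is the component
  gained by the deletion.\<close>

lemma bridge_family_eq:
  assumes G: "fin_simple_graph V E" and e: "e \<in> E"
  shows "bridge_family V E e i = insert e `
    {F. F \<subseteq> E \<and> num_components V F = i + 1 \<and> (\<forall>U\<in>components V F. \<not> e \<subseteq> U)}"
    (is "_ = insert e ` ?S")
proof (intro equalityI subsetI)
  have eV: "e \<subseteq> V" "card e = 2" using G e by (auto simp: fin_simple_graph_def)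
  note bridge = num_components_delete_bridge_iff[OF fin_simple_graph_subset[OF G] eV]
  {
    fix F assume "F \<in> bridge_family V E e i"
    then have F: "F \<subseteq> E" "e \<in> F" "num_components V F = i"
      "num_components V (F - {e}) = num_components V F + 1"
      by (auto simp: bridge_family_def is_bridge_def)
    then have "F - {e} \<in> ?S"
      using bridge[of "F - {e}"] by (auto simp: insert_absorb)
    then show "F \<in> insert e ` ?S"
      using F(2) by (intro image_eqI[of _ _ "F - {e}"]) auto
  next
    fix H assume "H \<in> insert e ` ?S"
    then obtain F where H: "H = insert e F" and F: "F \<in> ?S" by blast
    then have "e \<notin> F"
      using edge_in_component[OF fin_simple_graph_subset[OF G], of F e] by blast
    then show "H \<in> bridge_family V E e i"
      using F H e bridge[of F] by (auto simp: bridge_family_def is_bridge_def)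
  }
qed

text \<open>Distributivity expands the product into a sum over functions \<open>g\<close> choosing a
  connected spanning edge set in each block. Taking the union of the choices matches these functions
  bijectively with the edge sets whose components are \<open>P\<close>.\<close>

lemma sum_with_components_eq_prod_a1:
  assumes G: "fin_simple_graph V E" and P: "partition_on V P"
  shows "(\<Sum>F | F \<subseteq> E \<and> components V F = P. (- 1 :: int) ^ card F) =
    (\<Prod>U\<in>P. a1 U (induced_edges E U))"
proof -
  define C where "C U = {F. F \<subseteq> induced_edges E U \<and> num_components U F = 1}" for U
  have finE: "finite E" using G by (rule fin_simple_graph_finite_edges)
  have finP: "finite P" using G P finite_elements by (auto simp: fin_simple_graph_def)
  have finC: "finite (C U)" for U
    unfolding C_def by (rule finite_subset[of _ "Pow E"]) (auto simp: finE induced_edges_def)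
  \<comment> \<open>Edges are non-empty, so an edge lies in at most one block. This makes the chosen
    edge sets disjoint and lets \<open>g\<close> be recovered from their union.\<close>
  have block: "W = U" if "U \<in> P" "W \<in> P" "f \<in> E" "f \<subseteq> U" "f \<subseteq> W" for U W f
  proof -
    have "f \<noteq> {}" using G that(3) by (auto simp: fin_simple_graph_def)
    then obtain x where "x \<in> f" by blast
    then show ?thesis using partition_on_block_unique[OF P] that by blast
  qed
  have CD: "f \<in> E" "f \<subseteq> U" if "g \<in> Pi\<^sub>E P C" "U \<in> P" "f \<in> g U" for g U f
    using PiE_mem[OF that(1,2)] that(3) by (auto simp: C_def induced_edges_def)
  have ind: "induced_edges (\<Union>(g ` P)) U = g U" if "g \<in> Pi\<^sub>E P C" "U \<in> P" for g U
  proof (intro equalityI subsetI)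
    fix f assume "f \<in> induced_edges (\<Union>(g ` P)) U"
    then obtain W where W: "W \<in> P" "f \<in> g W" and "f \<subseteq> U" by (auto simp: induced_edges_def)
    then have "W = U" using block[OF that(2) W(1)] CD[OF that(1) W] by blast
    then show "f \<in> g U" using W by simp
  next
    fix f assume "f \<in> g U"
    then show "f \<in> induced_edges (\<Union>(g ` P)) U"
      using that(2) CD(2)[OF that] by (auto simp: induced_edges_def)
  qed
  have "(\<Prod>U\<in>P. a1 U (induced_edges E U)) = (\<Sum>g\<in>Pi\<^sub>E P C. \<Prod>U\<in>P. (- 1) ^ card (g U))"
    unfolding a1_def C_def[symmetric] by (rule prod_sum_PiE) (simp_all add: finP finC)
  also have "\<dots> = (\<Sum>F | F \<subseteq> E \<and> components V F = P. (- 1) ^ card F)"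
  \<comment> \<open>The inverse map restricts \<open>F\<close> to each block; it is cut off outside
    \<open>P\<close> because members of \<open>Pi\<^sub>E P C\<close> are extensional.\<close>
  proof (rule sum.reindex_bij_witness[of _ "\<lambda>F. \<lambda>U\<in>P. induced_edges F U" "\<lambda>g. \<Union>(g ` P)"])
    fix g assume g: "g \<in> Pi\<^sub>E P C"
    show "(\<lambda>U\<in>P. induced_edges (\<Union>(g ` P)) U) = g"
    proof (rule extensionalityI[of _ P])
      show "g \<in> extensional P" using g by (simp add: PiE_def)
    qed (simp_all add: ind[OF g])
    have sub: "\<Union>(g ` P) \<subseteq> E" using CD[OF g] by blast
    have "num_components U (g U) = 1" if "U \<in> P" for U
      using PiE_mem[OF g that] by (simp add: C_def)
    moreover have "\<exists>U\<in>P. f \<subseteq> U" if "f \<in> \<Union>(g ` P)" for f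
      using that CD(2)[OF g] by (meson UN_E)
    ultimately have "components V (\<Union>(g ` P)) = P"
      by (intro components_eqI[OF P]) (simp_all only: ind[OF g])
    with sub show "\<Union>(g ` P) \<in> {F. F \<subseteq> E \<and> components V F = P}" by simp
    \<comment> \<open>Disjointness makes the cardinalities add, so the sign of the union is the
      product of the signs.\<close>
    have "card (\<Union>(g ` P)) = (\<Sum>U\<in>P. card (g U))"
    proof (rule card_UN_disjoint[OF finP])
      show "\<forall>U\<in>P. finite (g U)" using CD(1)[OF g] finite_subset[OF _ finE] by (meson subsetI)
      show "\<forall>U\<in>P. \<forall>W\<in>P. U \<noteq> W \<longrightarrow> g U \<inter> g W = {}" 
        using CD[OF g] block by (meson disjoint_iff)
    qed
    then show "(- 1) ^ card (\<Union>(g ` P)) = (\<Prod>U\<in>P. (- 1 :: int) ^ card (g U))"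
      by (simp add: power_sum)
  next
    fix F assume "F \<in> {F. F \<subseteq> E \<and> components V F = P}"
    then have F: "F \<subseteq> E" "components V F = P" by auto
    have props: "\<forall>f\<in>F. \<exists>U\<in>P. f \<subseteq> U" "\<forall>U\<in>P. num_components U (induced_edges F U) = 1"
      using F components_eq_iff[OF fin_simple_graph_subset[OF G F(1)], of P] by auto
    show "\<Union>((\<lambda>U\<in>P. induced_edges F U) ` P) = F"
      using props(1) by (auto simp: induced_edges_def)
    show "(\<lambda>U\<in>P. induced_edges F U) \<in> Pi\<^sub>E P C"
      using props(2) F(1) by (auto simp: C_def induced_edges_def)
  qed
  finally show ?thesis by simp
qed

theorem lemma2p5:
  fixes V :: "'a set" and E :: "'a set set" and e :: "'a set" and i :: nat
  assumes "fin_simple_graph V E"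
    and "V \<noteq> {}" and "E \<noteq> {}"
    and "e \<in> E"
    and "i \<ge> 1"
  shows "bridge_sum V E e i =
    - (\<Sum>P\<in>{P. partition_on V P \<and> card P = i + 1 \<and> (\<forall>U\<in>P. e \<notin> induced_edges E U)}.
         \<Prod>U\<in>P. a1 U (induced_edges E U))"
proof -
  note G = assms(1) and e = assms(4)
  let ?S = "{F. F \<subseteq> E \<and> num_components V F = i + 1 \<and> (\<forall>U\<in>components V F. \<not> e \<subseteq> U)}"
  let ?Q = "{P. partition_on V P \<and> card P = i + 1 \<and> (\<forall>U\<in>P. e \<notin> induced_edges E U)}"
  have finE: "finite E" using G by (rule fin_simple_graph_finite_edges)
  then have finS: "finite ?S" by (auto intro: finite_subset[of _ "Pow E"])
  have finQ: "finite ?Q"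
    using finitely_many_partition_on[of V] G by (simp add: fin_simple_graph_def)
  \<comment> \<open>Needed twice: \<open>insert e\<close> is injective on \<open>?S\<close>, and it
    raises each cardinality by one, which flips the sign.\<close>
  have notin: "e \<notin> F" if "F \<in> ?S" for F
    using that edge_in_component[OF fin_simple_graph_subset[OF G], of F e] by blast
  have "bridge_sum V E e i = (\<Sum>F\<in>?S. (- 1) ^ card (insert e F))"
    unfolding bridge_sum_def
  proof (rule sum.reindex_cong[OF _ bridge_family_eq[OF G e] refl])
    show "inj_on (insert e) ?S"
      using insert_ident[OF notin notin] by (intro inj_onI) blast
  qed
  also have "\<dots> = (\<Sum>F\<in>?S. - ((- 1) ^ card F))"
  proof (rule sum.cong[OF refl])
    fix F assume F: "F \<in> ?S"
    then have "finite F" using finE finite_subset by blast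
    then show "(- 1 :: int) ^ card (insert e F) = - ((- 1) ^ card F)" using notin[OF F] by simp
  qed
  also have "\<dots> = - (\<Sum>F\<in>?S. (- 1) ^ card F)" by (rule sum_negf)
  also have "(\<Sum>F\<in>?S. (- 1 :: int) ^ card F) =
      (\<Sum>P\<in>?Q. \<Sum>F | F \<in> ?S \<and> components V F = P. (- 1) ^ card F)"
    using partition_on_components
    by (intro sum.group[OF finS finQ, symmetric])
      (auto simp: num_components_def induced_edges_def)
  also have "\<dots> = (\<Sum>P\<in>?Q. \<Prod>U\<in>P. a1 U (induced_edges E U))"
  proof (rule sum.cong[OF refl])
    fix P assume P: "P \<in> ?Q"
    \<comment> \<open>As \<open>e \<in> E\<close>, not being an induced edge of a block means not
      being contained in it. So the remaining conditions of \<open>?S\<close> already follow from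
      \<open>P \<in> ?Q\<close>.\<close>
    then have "{F. F \<in> ?S \<and> components V F = P} = {F. F \<subseteq> E \<and> components V F = P}"
      using e by (auto simp: num_components_def induced_edges_def)
    then show "(\<Sum>F | F \<in> ?S \<and> components V F = P. (- 1 :: int) ^ card F) =
        (\<Prod>U\<in>P. a1 U (induced_edges E U))"
      using sum_with_components_eq_prod_a1[OF G, of P] P by simp
  qed
  finally show ?thesis .
qed

end
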